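(* Let $T$ be a truss, $M$ a left $T$-module and $e\in M$. The extension truss $T[M;e]$ is a truss associated to a (two-sided) brace if and only if $T$ is associated to a (two-sided) brace and $M$ is a unital $T$-module.
   Context: A heap is a set $H$ with a ternary operation $[-,-,-]$ such that $[[a,b,c],d,e]=[a,b,[c,d,e]]$ and $[b,b,a]=a=[a,b,b]$; it is abelian if $[a,b,c]=[c,b,a]$. A truss is an abelian heap $T$ with an associative binary multiplication such that $a[b,c,d]=[ab,ac,ad]$ and $[b,c,d]a=[ba,ca,da]$. A left $T$-module is an abelian heap $M$ with an action $(t,m)\mapsto t\cdot m$ such that $t\cdot(t'\cdot m)=(tt')\cdot m$, $[t,t',t'']\cdot m=[t\cdot m,t'\cdot m,t''\cdot m]$ and $t\cdot[m,m',m'']=[t\cdot m,t\cdot m',t\cdot m'']$; it is unital if $T$ has a multiplicative identity $1$ and $1\cdot m=m$ for all $m\in M$. For $e\in M$, $T[M;e]$ is the truss on $T\times M$ with the componentwise heap operation and multiplication $(t,m)(t',m')=(tt',[m,t\cdot e,t\cdot m'])$. A two-sided brace is a set $B$ with two group operations, $+$ (commutative) and $\cdot$, such that $a(b+c)=ab-a+ac$ and $(b+c)a=ba-a+ca$ for all $a,b,c\in B$. The truss associated to $B$ is $\mathrm{T}(B)$: the set $B$ with $[a,b,c]=a-b+c$ and multiplication $\cdot$. A truss is associated to a brace if it equals $\mathrm{T}(B)$ for some two-sided brace $B$; equivalently, if its multiplication is a group operation (the addition then being $x+y=[x,1,y]$). *)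

theory Defs
  imports "HOL-Algebra.Ring"
begin

text \<open>Heaps, trusses and truss modules may be empty; in particular a heap has no distinguished
  element and a truss need not have a multiplicative identity.\<close>

record 'a heap = "'a partial_object" +
  hop :: "'a \<Rightarrow> 'a \<Rightarrow> 'a \<Rightarrow> 'a"

locale heap =
  fixes H :: "('a, 'b) heap_scheme" (structure)
  assumes hop_closed:
      "\<lbrakk>a \<in> carrier H; b \<in> carrier H; c \<in> carrier H\<rbrakk> \<Longrightarrow> hop H a b c \<in> carrier H"
    and hop_assoc:
      "\<lbrakk>a \<in> carrier H; b \<in> carrier H; c \<in> carrier H; d \<in> carrier H; e \<in> carrier H\<rbrakk>
        \<Longrightarrow> hop H (hop H a b c) d e = hop H a b (hop H c d e)"
    and hop_left: "\<lbrakk>a \<in> carrier H; b \<in> carrier H\<rbrakk> \<Longrightarrow> hop H b b a = a"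
    and hop_right: "\<lbrakk>a \<in> carrier H; b \<in> carrier H\<rbrakk> \<Longrightarrow> hop H a b b = a"

locale abelian_heap = heap +
  assumes hop_commute:
    "\<lbrakk>a \<in> carrier H; b \<in> carrier H; c \<in> carrier H\<rbrakk> \<Longrightarrow> hop H a b c = hop H c b a"

record 'a truss = "'a heap" +
  tmult :: "'a \<Rightarrow> 'a \<Rightarrow> 'a" (infixl "\<star>\<index>" 70)

locale truss = abelian_heap T for T :: "('a, 'b) truss_scheme" (structure) +
  assumes tmult_closed: "\<lbrakk>a \<in> carrier T; b \<in> carrier T\<rbrakk> \<Longrightarrow> a \<star> b \<in> carrier T"
    and tmult_assoc:
      "\<lbrakk>a \<in> carrier T; b \<in> carrier T; c \<in> carrier T\<rbrakk> \<Longrightarrow> (a \<star> b) \<star> c = a \<star> (b \<star> c)"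
    and tmult_hop_left:
      "\<lbrakk>a \<in> carrier T; b \<in> carrier T; c \<in> carrier T; d \<in> carrier T\<rbrakk>
        \<Longrightarrow> a \<star> hop T b c d = hop T (a \<star> b) (a \<star> c) (a \<star> d)"
    and tmult_hop_right:
      "\<lbrakk>a \<in> carrier T; b \<in> carrier T; c \<in> carrier T; d \<in> carrier T\<rbrakk>
        \<Longrightarrow> hop T b c d \<star> a = hop T (b \<star> a) (c \<star> a) (d \<star> a)"

record ('t, 'm) truss_module = "'m heap" +
  act :: "'t \<Rightarrow> 'm \<Rightarrow> 'm" (infixr "\<cdot>\<index>" 75)

locale truss_module = truss T + M: abelian_heap M
  for T :: "('t, 'b) truss_scheme" (structure) and M :: "('t, 'm, 'c) truss_module_scheme" +
  assumes act_closed: "\<lbrakk>t \<in> carrier T; m \<in> carrier M\<rbrakk> \<Longrightarrow> t \<cdot>\<^bsub>M\<^esub> m \<in> carrier M"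
    and act_assoc:
      "\<lbrakk>t \<in> carrier T; t' \<in> carrier T; m \<in> carrier M\<rbrakk>
        \<Longrightarrow> t \<cdot>\<^bsub>M\<^esub> (t' \<cdot>\<^bsub>M\<^esub> m) = (t \<star> t') \<cdot>\<^bsub>M\<^esub> m"
    and act_hop_left:
      "\<lbrakk>t \<in> carrier T; t' \<in> carrier T; t'' \<in> carrier T; m \<in> carrier M\<rbrakk>
        \<Longrightarrow> hop T t t' t'' \<cdot>\<^bsub>M\<^esub> m = hop M (t \<cdot>\<^bsub>M\<^esub> m) (t' \<cdot>\<^bsub>M\<^esub> m) (t'' \<cdot>\<^bsub>M\<^esub> m)"
    and act_hop_right:
      "\<lbrakk>t \<in> carrier T; m \<in> carrier M; m' \<in> carrier M; m'' \<in> carrier M\<rbrakk>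
        \<Longrightarrow> t \<cdot>\<^bsub>M\<^esub> hop M m m' m'' = hop M (t \<cdot>\<^bsub>M\<^esub> m) (t \<cdot>\<^bsub>M\<^esub> m') (t \<cdot>\<^bsub>M\<^esub> m'')"

definition is_truss_identity :: "('a, 'b) truss_scheme \<Rightarrow> 'a \<Rightarrow> bool" where
  "is_truss_identity T u \<longleftrightarrow>
     u \<in> carrier T \<and> (\<forall>t \<in> carrier T. u \<star>\<^bsub>T\<^esub> t = t \<and> t \<star>\<^bsub>T\<^esub> u = t)"

definition unital_truss_module ::
  "('t, 'b) truss_scheme \<Rightarrow> ('t, 'm, 'c) truss_module_scheme \<Rightarrow> bool" where
  "unital_truss_module T M \<longleftrightarrow>
     truss_module T M \<and>
     (\<exists>u. is_truss_identity T u \<and> (\<forall>m \<in> carrier M. u \<cdot>\<^bsub>M\<^esub> m = m))"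

definition extension_truss ::
  "('t, 'b) truss_scheme \<Rightarrow> ('t, 'm, 'c) truss_module_scheme \<Rightarrow> 'm \<Rightarrow> ('t \<times> 'm) truss" where
  "extension_truss T M e =
     \<lparr>carrier = carrier T \<times> carrier M,
      hop = (\<lambda>(a, x) (b, y) (c, z). (hop T a b c, hop M x y z)),
      tmult = (\<lambda>(t, m) (t', m'). (t \<star>\<^bsub>T\<^esub> t', hop M m (t \<cdot>\<^bsub>M\<^esub> e) (t \<cdot>\<^bsub>M\<^esub> m')))\<rparr>"

text \<open>The type of ring records only serves to carry two binary operations with a neutral element
  each; neither ring distributivity nor \<open>\<one> = \<zero>\<close> is assumed (the latter follows).\<close>

locale two_sided_brace = abelian_group B + group B
  for B :: "('a, 'b) ring_scheme" (structure) +
  assumes brace_left: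
      "\<lbrakk>a \<in> carrier B; b \<in> carrier B; c \<in> carrier B\<rbrakk>
        \<Longrightarrow> a \<otimes> (b \<oplus> c) = ((a \<otimes> b) \<ominus> a) \<oplus> (a \<otimes> c)"
    and brace_right:
      "\<lbrakk>a \<in> carrier B; b \<in> carrier B; c \<in> carrier B\<rbrakk>
        \<Longrightarrow> (b \<oplus> c) \<otimes> a = ((b \<otimes> a) \<ominus> a) \<oplus> (c \<otimes> a)"

definition brace_truss :: "('a, 'b) ring_scheme \<Rightarrow> 'a truss" where
  "brace_truss B =
     \<lparr>carrier = carrier B,
      hop = (\<lambda>a b c. (a \<ominus>\<^bsub>B\<^esub> b) \<oplus>\<^bsub>B\<^esub> c),
      tmult = (\<lambda>a b. a \<otimes>\<^bsub>B\<^esub> b)\<rparr>"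

text \<open>Equality of trusses as mathematical structures: the operations of the records are total
  functions, whose values outside the carrier are irrelevant.\<close>

definition truss_eq :: "('a, 'b) truss_scheme \<Rightarrow> ('a, 'c) truss_scheme \<Rightarrow> bool" where
  "truss_eq S T \<longleftrightarrow>
     carrier S = carrier T \<and>
     (\<forall>a \<in> carrier S. \<forall>b \<in> carrier S. \<forall>c \<in> carrier S. hop S a b c = hop T a b c) \<and>
     (\<forall>a \<in> carrier S. \<forall>b \<in> carrier S. a \<star>\<^bsub>S\<^esub> b = a \<star>\<^bsub>T\<^esub> b)"

definition associated_to_brace :: "('a, 'b) truss_scheme \<Rightarrow> bool" where
  "associated_to_brace T \<longleftrightarrow>
     (\<exists>B :: 'a ring. two_sided_brace B \<and> truss_eq T (brace_truss B))"

end

theory Submission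
  imports Defs
begin

text \<open>A truss is associated to a brace exactly when its multiplication is a group operation, the
  addition being recovered by retracting the heap at the multiplicative identity. If \<open>(u, v)\<close> is an
  identity of \<open>T[M;e]\<close>, then \<open>[v, u \<cdot> e, u \<cdot> m] = m\<close> for all \<open>m\<close>; taking \<open>m = e\<close> gives \<open>v = e\<close>, and
  then \<open>m = u \<cdot> e\<close> gives \<open>u \<cdot> e = e\<close>, so that \<open>u \<cdot> m = m\<close>. Conversely, if \<open>s\<close> is the inverse of \<open>t\<close>,
  then \<open>(s, [e, s \<cdot> m, s \<cdot> e])\<close> is the inverse of \<open>(t, m)\<close>.\<close>

section \<open>Abelian heaps as commutative groups with a chosen base point\<close>

definition heap_retract :: "('a, 'b) heap_scheme \<Rightarrow> 'a \<Rightarrow> 'a monoid" where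
  "heap_retract H u = \<lparr>carrier = carrier H, mult = (\<lambda>x y. hop H x u y), one = u\<rparr>"

context abelian_heap
begin

lemma comm_group_heap_retract:
  assumes u: "u \<in> carrier H"
  shows "comm_group (heap_retract H u)"
proof (rule comm_groupI)
  fix x assume "x \<in> carrier (heap_retract H u)"
  then have x: "x \<in> carrier H" by (simp add: heap_retract_def)
  \<comment> \<open>The negative of \<open>x\<close> is [u,x,u]: by associativity the sum is
    [u,x,[u,u,x]] = [u,x,x] = u.\<close>
  have "hop H (hop H u x u) u x = u"
    by (simp add: u x hop_assoc hop_left hop_right)
  then show "\<exists>y\<in>carrier (heap_retract H u). y \<otimes>\<^bsub>heap_retract H u\<^esub> x = \<one>\<^bsub>heap_retract H u\<^esub>"
    using u x by (auto simp: heap_retract_def intro!: bexI[of _ "hop H u x u"] hop_closed)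
next
  fix x y assume "x \<in> carrier (heap_retract H u)" "y \<in> carrier (heap_retract H u)"
  then show "x \<otimes>\<^bsub>heap_retract H u\<^esub> y = y \<otimes>\<^bsub>heap_retract H u\<^esub> x"
    using u hop_commute by (simp add: heap_retract_def)
qed (simp_all add: heap_retract_def u hop_closed hop_assoc hop_left)

lemma inv_heap_retract:
  assumes u: "u \<in> carrier H" and x: "x \<in> carrier H"
  shows "inv\<^bsub>heap_retract H u\<^esub> x = hop H u x u"
proof -
  interpret R: comm_group "heap_retract H u"
    by (rule comm_group_heap_retract[OF u])
  have "hop H u x u \<otimes>\<^bsub>heap_retract H u\<^esub> x = \<one>\<^bsub>heap_retract H u\<^esub>"
    by (simp add: heap_retract_def u x hop_assoc hop_left hop_right)
  then show ?thesis
    using u x by (intro R.inv_equality) (auto simp: heap_retract_def hop_closed)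
qed

text \<open>Inserting the base point gives [a,b,c] = [[a,u,[u,b,u]],u,c], where [u,b,u] is the
  negative of \<open>b\<close>. Heap identities thereby become identities in a commutative group,
  whichever base point is chosen.\<close>

lemma hop_eq_heap_retract:
  assumes u: "u \<in> carrier H"
    and a: "a \<in> carrier H" and b: "b \<in> carrier H" and c: "c \<in> carrier H"
  shows "hop H a b c
    = a \<otimes>\<^bsub>heap_retract H u\<^esub> inv\<^bsub>heap_retract H u\<^esub> b \<otimes>\<^bsub>heap_retract H u\<^esub> c"
proof -
  have "hop H (hop H a u (hop H u b u)) u c = hop H a u (hop H u b c)"
    by (simp add: u a b c hop_closed hop_assoc hop_left)
  also have "\<dots> = hop H (hop H a u u) b c"
    by (rule hop_assoc[OF a u u b c, symmetric])
  finally have "hop H (hop H a u (hop H u b u)) u c = hop H a b c"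
    by (simp add: a u hop_right)
  then show ?thesis
    by (simp add: inv_heap_retract u b) (simp add: heap_retract_def)
qed

text \<open>In a commutative group both sides are the same signed sum of nine terms. This is the
  identity behind both distributive laws of the extension truss.\<close>

lemma hop_medial:
  assumes "a \<in> carrier H" "b \<in> carrier H" "c \<in> carrier H"
    "a' \<in> carrier H" "b' \<in> carrier H" "c' \<in> carrier H"
    "a'' \<in> carrier H" "b'' \<in> carrier H" "c'' \<in> carrier H"
  shows "hop H (hop H a b c) (hop H a' b' c') (hop H a'' b'' c'')
    = hop H (hop H a a' a'') (hop H b b' b'') (hop H c c' c'')"
proof -
  let ?R = "heap_retract H a"
  interpret R: comm_group ?R
    by (rule comm_group_heap_retract[OF assms(1)])
  have [simp]: "carrier ?R = carrier H"
    by (simp add: heap_retract_def)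
  note closed = R.m_closed[simplified] R.inv_closed[simplified]
  show ?thesis
    using assms by (simp add: hop_eq_heap_retract[of a] closed R.inv_mult_group R.m_ac)
qed

end

section \<open>Trusses whose multiplication is a group operation\<close>

definition has_left_inverses :: "('a, 'b) truss_scheme \<Rightarrow> 'a \<Rightarrow> bool" where
  "has_left_inverses T u \<longleftrightarrow> (\<forall>t \<in> carrier T. \<exists>s \<in> carrier T. s \<star>\<^bsub>T\<^esub> t = u)"

text \<open>The two neutral elements of a brace coincide, so the multiplicative identity has to
  serve as base point of the addition.\<close>

definition retract_brace :: "('a, 'b) truss_scheme \<Rightarrow> 'a \<Rightarrow> 'a ring" where
  "retract_brace T u =
     \<lparr>carrier = carrier T, mult = tmult T, one = u, zero = u, add = (\<lambda>x y. hop T x u y)\<rparr>"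

context truss
begin

lemma retract_brace_minus_add:
  assumes "u \<in> carrier T" "a \<in> carrier T" "b \<in> carrier T" "c \<in> carrier T"
  shows "(a \<ominus>\<^bsub>retract_brace T u\<^esub> b) \<oplus>\<^bsub>retract_brace T u\<^esub> c = hop T a b c"
proof -
  have "add_monoid (retract_brace T u) = heap_retract T u"
    by (simp add: retract_brace_def heap_retract_def)
  then have "\<ominus>\<^bsub>retract_brace T u\<^esub> b = inv\<^bsub>heap_retract T u\<^esub> b"
    by (simp add: a_inv_def)
  then show ?thesis
    using hop_eq_heap_retract[OF assms]
    by (simp add: a_minus_def) (simp add: retract_brace_def heap_retract_def)
qed

text \<open>The brace laws are truss distributivity over [b,u,c]: since a u = a = u a, the middle
  term of a[b,u,c] = [ab,au,ac] is \<open>a\<close>, and likewise on the right. Left inverses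
  together with a two-sided identity already give a group.\<close>

lemma two_sided_brace_retract_brace:
  assumes u: "is_truss_identity T u" and inv: "has_left_inverses T u"
  shows "two_sided_brace (retract_brace T u)"
proof -
  let ?B = "retract_brace T u"
  have uT: "u \<in> carrier T"
    using u by (simp add: is_truss_identity_def)
  have add: "add_monoid ?B = heap_retract T u"
    by (simp add: retract_brace_def heap_retract_def)
  interpret A: comm_group "add_monoid ?B"
    unfolding add by (rule comm_group_heap_retract[OF uT])
  have ab: "abelian_group ?B"
    by (intro abelian_group.intro abelian_monoid.intro abelian_group_axioms.intro)
      unfold_locales
  have grp: "group ?B"
    using u inv
    by (intro groupI)
      (auto simp: retract_brace_def is_truss_identity_def has_left_inverses_def
        tmult_closed tmult_assoc)
  show ?thesis
  proof (intro two_sided_brace.intro ab grp two_sided_brace_axioms.intro)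
    fix a b c
    assume "a \<in> carrier ?B" "b \<in> carrier ?B" "c \<in> carrier ?B"
    then have abc: "a \<in> carrier T" "b \<in> carrier T" "c \<in> carrier T"
      by (simp_all add: retract_brace_def)
    have ops: "x \<otimes>\<^bsub>?B\<^esub> y = x \<star> y" "x \<oplus>\<^bsub>?B\<^esub> y = hop T x u y" for x y
      by (simp_all add: retract_brace_def)
    have unit: "a \<star> u = a" "u \<star> a = a"
      using u abc by (auto simp: is_truss_identity_def)
    show "a \<otimes>\<^bsub>?B\<^esub> (b \<oplus>\<^bsub>?B\<^esub> c) = ((a \<otimes>\<^bsub>?B\<^esub> b) \<ominus>\<^bsub>?B\<^esub> a) \<oplus>\<^bsub>?B\<^esub> (a \<otimes>\<^bsub>?B\<^esub> c)"
      by (subst retract_brace_minus_add)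
        (simp_all add: uT abc ops tmult_closed tmult_hop_left unit)
    show "(b \<oplus>\<^bsub>?B\<^esub> c) \<otimes>\<^bsub>?B\<^esub> a = ((b \<otimes>\<^bsub>?B\<^esub> a) \<ominus>\<^bsub>?B\<^esub> a) \<oplus>\<^bsub>?B\<^esub> (c \<otimes>\<^bsub>?B\<^esub> a)"
      by (subst retract_brace_minus_add)
        (simp_all add: uT abc ops tmult_closed tmult_hop_right unit)
  qed
qed

text \<open>Trades the existence of a brace for a property of the multiplication alone, so that
  \<open>T\<close> and its extension can be compared through identities and left inverses.\<close>

lemma associated_to_brace_iff:
  "associated_to_brace T \<longleftrightarrow> (\<exists>u. is_truss_identity T u \<and> has_left_inverses T u)"
proof
  assume "associated_to_brace T"
  then obtain B :: "'a ring" where "two_sided_brace B" and eq: "truss_eq T (brace_truss B)"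
    by (auto simp: associated_to_brace_def)
  then interpret B: two_sided_brace B by simp
  have carr: "carrier T = carrier B"
    using eq by (simp add: truss_eq_def brace_truss_def)
  have mult: "a \<star> b = a \<otimes>\<^bsub>B\<^esub> b" if "a \<in> carrier B" "b \<in> carrier B" for a b
    using eq that by (simp add: truss_eq_def brace_truss_def)
  have "is_truss_identity T \<one>\<^bsub>B\<^esub>"
    by (simp add: is_truss_identity_def carr mult)
  moreover have "has_left_inverses T \<one>\<^bsub>B\<^esub>"
    unfolding has_left_inverses_def carr
    by (metis B.inv_closed B.l_inv mult)
  ultimately show "\<exists>u. is_truss_identity T u \<and> has_left_inverses T u" by blast
next
  assume "\<exists>u. is_truss_identity T u \<and> has_left_inverses T u"
  then obtain u where u: "is_truss_identity T u" and inv: "has_left_inverses T u" by blast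
  then have "u \<in> carrier T"
    by (simp add: is_truss_identity_def)
  then have "truss_eq T (brace_truss (retract_brace T u))"
    by (simp add: truss_eq_def brace_truss_def retract_brace_minus_add)
      (simp add: retract_brace_def)
  then show "associated_to_brace T"
    using two_sided_brace_retract_brace[OF u inv] by (auto simp: associated_to_brace_def)
qed

lemma truss_identity_unique:
  assumes "is_truss_identity T u" "is_truss_identity T v"
  shows "u = v"
  using assms unfolding is_truss_identity_def by metis

end

section \<open>The extension truss, its identities and its inverses\<close>

context truss_module
begin

lemma extension_carrier: "carrier (extension_truss T M e) = carrier T \<times> carrier M"
  by (simp add: extension_truss_def)

lemma extension_hop:
  "hop (extension_truss T M e) (a, x) (b, y) (c, z) = (hop T a b c, hop M x y z)"
  by (simp add: extension_truss_def)

lemma extension_mult: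
  "(t, m) \<star>\<^bsub>extension_truss T M e\<^esub> (t', m')
    = (t \<star> t', hop M m (t \<cdot>\<^bsub>M\<^esub> e) (t \<cdot>\<^bsub>M\<^esub> m'))"
  by (simp add: extension_truss_def)

lemmas extension_simps = extension_carrier extension_hop extension_mult

lemma truss_extension_truss:
  assumes e: "e \<in> carrier M"
  shows "truss (extension_truss T M e)" (is "truss ?E")
proof -
  note closed = hop_closed M.hop_closed tmult_closed act_closed
  \<comment> \<open>Write m = [m,m,m] and x = [x,x,x] and apply the medial law; with x = t e this is
    left distributivity in the second component.\<close>
  have left: "hop M m x (hop M a b c) = hop M (hop M m x a) (hop M m x b) (hop M m x c)"
    if "m \<in> carrier M" "x \<in> carrier M" "a \<in> carrier M" "b \<in> carrier M" "c \<in> carrier M"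
    for m x a b c
    using M.hop_medial[of m m m x x x a b c] that by (simp add: M.hop_left)
  show ?thesis
  \<comment> \<open>Goals 1 to 4 are the heap axioms, 5 is commutativity, 6 and 7 are closure and
    associativity of the product, 8 and 9 the left and right distributive laws.\<close>
  proof (unfold_locales, goal_cases)
    case 5
    then show ?case
      by (auto simp: extension_simps) (rule hop_commute M.hop_commute; assumption)+
  next
    case 6
    then show ?case by (auto simp: extension_simps e closed)
  next
    case 7
    then show ?case
      by (auto simp: extension_simps e closed tmult_assoc act_hop_right act_assoc M.hop_assoc)
  next
    case 8
    then show ?case
      by (auto simp: extension_simps e closed tmult_hop_left act_hop_right intro!: left)
  next
    case 9
    then show ?case
      by (auto simp: extension_simps e closed tmult_hop_right act_hop_left
          intro!: M.hop_medial)
  qed (auto simp: extension_simps closed hop_assoc M.hop_assoc hop_left M.hop_left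
      hop_right M.hop_right)
qed

lemma extension_identityD:
  assumes e: "e \<in> carrier M" and id: "is_truss_identity (extension_truss T M e) (u, v)"
  shows "is_truss_identity T u" "v = e" "\<And>m. m \<in> carrier M \<Longrightarrow> u \<cdot>\<^bsub>M\<^esub> m = m"
proof -
  have u: "u \<in> carrier T" and v: "v \<in> carrier M"
    using id by (auto simp: is_truss_identity_def extension_simps)
  have unit: "u \<star> t = t" "t \<star> u = t" "hop M v (u \<cdot>\<^bsub>M\<^esub> e) (u \<cdot>\<^bsub>M\<^esub> m) = m"
    if "t \<in> carrier T" "m \<in> carrier M" for t m
    using id that by (auto simp: is_truss_identity_def extension_simps)
  show idT: "is_truss_identity T u"
    using unit(1,2)[OF _ e] u by (simp add: is_truss_identity_def)
  show ve: "v = e"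
    using unit(3)[OF u e] by (simp add: M.hop_right u v e act_closed)
  \<comment> \<open>As \<open>u\<close> is idempotent, taking m = u e in the identity law makes the
    last two heap entries equal and leaves v = u e.\<close>
  have "u \<cdot>\<^bsub>M\<^esub> u \<cdot>\<^bsub>M\<^esub> e = u \<cdot>\<^bsub>M\<^esub> e"
    using unit(1)[OF u e] by (simp add: act_assoc u e)
  then have ue: "u \<cdot>\<^bsub>M\<^esub> e = e"
    using unit(3)[OF u act_closed[OF u e]] by (simp add: M.hop_right u e act_closed ve)
  show "u \<cdot>\<^bsub>M\<^esub> m = m" if "m \<in> carrier M" for m
    using unit(3)[OF u that] by (simp add: ve ue M.hop_left u e act_closed that)
qed

lemma extension_identityI:
  assumes e: "e \<in> carrier M" and id: "is_truss_identity T u"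
    and unital: "\<And>m. m \<in> carrier M \<Longrightarrow> u \<cdot>\<^bsub>M\<^esub> m = m"
  shows "is_truss_identity (extension_truss T M e) (u, e)"
  using assms
  by (auto simp: is_truss_identity_def extension_simps M.hop_left M.hop_right act_closed)

lemma extension_left_inverses_iff:
  assumes e: "e \<in> carrier M"
  shows "has_left_inverses (extension_truss T M e) (u, e) \<longleftrightarrow> has_left_inverses T u"
proof
  assume "has_left_inverses (extension_truss T M e) (u, e)"
  then show "has_left_inverses T u"
    \<comment> \<open>Pair a given \<open>t\<close> with \<open>e\<close> and project a left inverse
      of this pair to its first component.\<close>
    using e by (fastforce simp: has_left_inverses_def extension_simps)
next
  assume inv: "has_left_inverses T u"
  show "has_left_inverses (extension_truss T M e) (u, e)"
    unfolding has_left_inverses_def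
  proof
    fix x assume "x \<in> carrier (extension_truss T M e)"
    then obtain t m where x: "x = (t, m)" and t: "t \<in> carrier T" and m: "m \<in> carrier M"
      by (auto simp: extension_carrier)
    obtain s where s: "s \<in> carrier T" and st: "s \<star> t = u"
      using inv t by (auto simp: has_left_inverses_def)
    \<comment> \<open>The second component solves [y, s e, s m] = e for \<open>y\<close>: indeed
      [[e, s m, s e], s e, s m] = [e, s m, s m] = e.\<close>
    have "(s, hop M e (s \<cdot>\<^bsub>M\<^esub> m) (s \<cdot>\<^bsub>M\<^esub> e)) \<star>\<^bsub>extension_truss T M e\<^esub> x = (u, e)"
      by (simp add: x extension_mult st s m e act_closed M.hop_assoc M.hop_left M.hop_right)
    then show "\<exists>y\<in>carrier (extension_truss T M e). y \<star>\<^bsub>extension_truss T M e\<^esub> x = (u, e)"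
      using s m e
      by (intro bexI[of _ "(s, hop M e (s \<cdot>\<^bsub>M\<^esub> m) (s \<cdot>\<^bsub>M\<^esub> e))"])
        (simp_all add: extension_carrier act_closed M.hop_closed)
  qed
qed

end

theorem corollary4p6:
  fixes T :: "'t truss" and M :: "('t, 'm) truss_module" and e :: 'm
  assumes "truss T"
    and "truss_module T M"
    and "e \<in> carrier M"
  shows "associated_to_brace (extension_truss T M e) \<longleftrightarrow>
    associated_to_brace T \<and> unital_truss_module T M"
proof -
  interpret truss_module T M by fact
  interpret E: truss "extension_truss T M e"
    by (rule truss_extension_truss) fact
  show ?thesis
  proof
    assume "associated_to_brace (extension_truss T M e)"
    then obtain u v where id: "is_truss_identity (extension_truss T M e) (u, v)"
      and inv: "has_left_inverses (extension_truss T M e) (u, v)"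
      unfolding E.associated_to_brace_iff by auto
    note u = extension_identityD[OF assms(3) id]
    have "has_left_inverses T u"
      using extension_left_inverses_iff[OF assms(3)] inv u(2) by simp
    then show "associated_to_brace T \<and> unital_truss_module T M"
      using u(1,3) assms(2) unfolding associated_to_brace_iff unital_truss_module_def by blast
  next
    assume "associated_to_brace T \<and> unital_truss_module T M"
    \<comment> \<open>The brace and the unital action each supply an identity of \<open>T\<close>;
      by uniqueness it is the same \<open>u\<close>.\<close>
    then obtain u where "is_truss_identity T u" "has_left_inverses T u"
      "\<And>m. m \<in> carrier M \<Longrightarrow> u \<cdot>\<^bsub>M\<^esub> m = m"
      unfolding associated_to_brace_iff unital_truss_module_def
      by (metis truss_identity_unique)
    then show "associated_to_brace (extension_truss T M e)"
      unfolding E.associated_to_brace_iff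
      using extension_identityI[OF assms(3)] extension_left_inverses_iff[OF assms(3)] by blast
  qed
qed

end
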